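(* Let $G$ be a finite simple graph. Then $G$ has an opposition if and only if the complement $\overline{G}$ has an opposition matching.
   Context: All graphs are finite and simple. $N[v]$ denotes the closed neighbourhood of $v$ (the vertex $v$ together with its neighbours). An opposition of a graph $G$ is an automorphism $f$ of $G$ of order two, in the sense $f\circ f=\mathrm{id}$, such that $f(v)\notin N[v]$ for all $v\in V(G)$ (so the empty graph vacuously has an opposition). A perfect matching $M$ of a graph $K$ is an opposition matching if for any two distinct edges $v_1v_2\neq v_3v_4$ in $M$, the subgraph of $K$ induced by $\{v_1,v_2,v_3,v_4\}$ is isomorphic to $K_4$, or isomorphic to $C_4$, or consists of just the two edges $v_1v_2$ and $v_3v_4$ of $M$. *)

theory Defs
  imports "Graph_Theory.Graph_Theory"
begin

text \<open>
  A finite simple graph is a \<^locale>\<open>pair_graph\<close>: each undirected edge \<open>uv\<close> is represented by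
  the two arcs \<open>(u, v)\<close> and \<open>(v, u)\<close>. The empty graph is allowed.
\<close>

definition uedges :: "('a, 'b) pre_digraph \<Rightarrow> 'a set set" where
  "uedges G = {{u, v} | u v. (u, v) \<in> arcs_ends G}"

definition complement :: "'a pair_pre_digraph \<Rightarrow> 'a pair_pre_digraph" where
  "complement G = \<lparr> pverts = pverts G,
     parcs = {(u, v). u \<in> pverts G \<and> v \<in> pverts G \<and> u \<noteq> v \<and> (u, v) \<notin> parcs G} \<rparr>"

definition closed_nbhd :: "'a pair_pre_digraph \<Rightarrow> 'a \<Rightarrow> 'a set" where
  "closed_nbhd G v = {v} \<union> {w. (v, w) \<in> parcs G}"

text \<open>
  The library's isomorphisms also carry an action on arcs; an automorphism here is the
  vertex part of an isomorphism from \<open>G\<close> onto itself.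
\<close>

definition automorphism :: "'a pair_pre_digraph \<Rightarrow> ('a \<Rightarrow> 'a) \<Rightarrow> bool" where
  "automorphism G f \<longleftrightarrow>
     (\<exists>h. pre_digraph.digraph_isomorphism (with_proj G) h \<and>
          app_iso h (with_proj G) = with_proj G \<and> iso_verts h = f)"

lemma automorphism_iff:
  assumes "pair_graph G"
  shows "automorphism G f \<longleftrightarrow>
    bij_betw f (pverts G) (pverts G) \<and>
    (\<forall>u\<in>pverts G. \<forall>v\<in>pverts G. (f u, f v) \<in> parcs G \<longleftrightarrow> (u, v) \<in> parcs G)"
    (is "?L \<longleftrightarrow> ?R")
proof -
  interpret pair_graph G by fact
  show ?thesis
  proof
    assume ?L
    then obtain h where h: "digraph_isomorphism h" "app_iso h (with_proj G) = with_proj G"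
      "iso_verts h = f"
      by (auto simp: automorphism_def)
    have ends: "iso_tail h = fst" "iso_head h = snd"
      using arg_cong[OF h(2), of tail] arg_cong[OF h(2), of head] by simp_all
    have V: "f ` pverts G = pverts G" and A: "iso_arcs h ` parcs G = parcs G"
      using arg_cong[OF h(2), of verts] arg_cong[OF h(2), of arcs] h(3) by simp_all
    have arc: "iso_arcs h e = (f (fst e), f (snd e))" if "e \<in> parcs G" for e
      using h(1,3) ends that by (auto simp: digraph_isomorphism_def prod_eq_iff)
    have inj: "inj_on f (pverts G)"
      using h(1,3) by (auto simp: digraph_isomorphism_def)
    have "(u, v) \<in> parcs G"
      if uv: "u \<in> pverts G" "v \<in> pverts G" "(f u, f v) \<in> parcs G" for u v
    proof -
      obtain e where e: "e \<in> parcs G" "iso_arcs h e = (f u, f v)"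
        using A uv(3) by (metis imageE)
      then have "f (fst e) = f u" "f (snd e) = f v"
        using arc by auto
      then have "e = (u, v)"
        using inj uv e(1) arc_fst_in_verts arc_snd_in_verts
        by (auto simp: prod_eq_iff dest: inj_onD)
      with e show ?thesis by simp
    qed
    moreover have "(f u, f v) \<in> parcs G" if "(u, v) \<in> parcs G" for u v
      using arc[OF that] A that by (metis fst_conv snd_conv imageI)
    ultimately show ?R
      using V inj by (auto simp: bij_betw_def)
  next
    assume R: ?R
    define h where "h = \<lparr> iso_verts = f, iso_arcs = map_prod f f,
      iso_head = snd, iso_tail = fst \<rparr>"
    have V: "f ` pverts G = pverts G" and inj: "inj_on f (pverts G)"
      using R by (auto simp: bij_betw_def)
    have sub: "parcs G \<subseteq> pverts G \<times> pverts G"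
      using in_arcsD1 in_arcsD2 by auto
    have "inj_on (map_prod f f) (parcs G)"
      using map_prod_inj_on[OF inj inj] sub by (rule inj_on_subset)
    moreover have "map_prod f f ` parcs G = parcs G"
    proof (intro equalityI subsetI)
      fix e assume "e \<in> map_prod f f ` parcs G"
      then show "e \<in> parcs G" using R sub by auto
    next
      fix e assume e: "e \<in> parcs G"
      have "fst e \<in> f ` pverts G" "snd e \<in> f ` pverts G"
        using e V arc_fst_in_verts arc_snd_in_verts by simp_all
      then obtain u v where uv: "u \<in> pverts G" "v \<in> pverts G" "fst e = f u" "snd e = f v"
        by (elim imageE) blast
      then have e_eq: "e = map_prod f f (u, v)"
        by (simp add: prod_eq_iff)
      with R uv e have "(u, v) \<in> parcs G" by simp
      with e_eq show "e \<in> map_prod f f ` parcs G" by blast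
    qed
    ultimately have "digraph_isomorphism h \<and> app_iso h (with_proj G) = with_proj G
        \<and> iso_verts h = f"
      using inj V wf_digraph by (auto simp: pre_digraph.digraph_isomorphism_def h_def app_iso_def with_proj_def)
    then show ?L by (auto simp: automorphism_def)
  qed
qed

definition opposition :: "'a pair_pre_digraph \<Rightarrow> ('a \<Rightarrow> 'a) \<Rightarrow> bool" where
  "opposition G f \<longleftrightarrow> automorphism G f \<and>
     (\<forall>v\<in>pverts G. f (f v) = v) \<and> (\<forall>v\<in>pverts G. f v \<notin> closed_nbhd G v)"

definition perfect_matching :: "'a pair_pre_digraph \<Rightarrow> 'a set set \<Rightarrow> bool" where
  "perfect_matching K M \<longleftrightarrow> M \<subseteq> uedges (with_proj K) \<and>
     (\<forall>e\<in>M. \<forall>e'\<in>M. e \<noteq> e' \<longrightarrow> e \<inter> e' = {}) \<and> \<Union>M = pverts K"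

text \<open>Only meaningful for \<open>n \<ge> 3\<close>.\<close>

definition cycle_graph :: "nat \<Rightarrow> nat pair_pre_digraph" where
  "cycle_graph n = \<lparr> pverts = {..<n},
     parcs = {(i, j). i < n \<and> j < n \<and> (j = Suc i mod n \<or> i = Suc j mod n)} \<rparr>"

text \<open>
  The library's \<^const>\<open>complete_digraph\<close> is closed under isomorphism, so the first disjunct
  says that the induced subgraph is isomorphic to the complete graph on four vertices.
\<close>

definition opposition_matching :: "'a pair_pre_digraph \<Rightarrow> 'a set set \<Rightarrow> bool" where
  "opposition_matching K M \<longleftrightarrow> perfect_matching K M \<and>
     (\<forall>e\<in>M. \<forall>e'\<in>M. e \<noteq> e' \<longrightarrow>
        (let H = with_proj K \<restriction> (e \<union> e') in
           complete_digraph 4 H \<or>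
           digraph_iso H (with_proj (cycle_graph 4)) \<or>
           uedges H = {e, e'}))"

lemma pair_graph_complement:
  assumes "pair_graph G"
  shows "pair_graph (complement G)"
proof -
  interpret pair_graph G by fact
  have "parcs (complement G) \<subseteq> pverts G \<times> pverts G"
    by (auto simp: complement_def)
  then have "finite (parcs (complement G))"
    using finite_subset pair_finite_verts by blast
  moreover have "(v, u) \<in> parcs G" if "(u, v) \<in> parcs G" for u v
    using that sym_arcs by (auto simp: symmetric_def sym_def)
  ultimately show ?thesis
    using pair_finite_verts
    by unfold_locales (auto simp: complement_def symmetric_def intro!: symI)
qed

end

theory Submission
  imports Defs
begin

text \<open>
  An opposition \<open>f\<close> and an opposition matching \<open>M\<close> determine each other through
  \<open>M = {{v, f v} | v. v \<in> V}\<close>. For two matching edges \<open>ab\<close> and \<open>cd\<close>, the three permitted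
  induced subgraphs are exactly those in which swapping \<open>a \<leftrightarrow> b\<close> and \<open>c \<leftrightarrow> d\<close> preserves
  adjacency: either both of the pairs \<open>ac\<close>, \<open>bd\<close> are edges or neither is, and likewise for
  \<open>ad\<close>, \<open>bc\<close>. A bijection preserves adjacency in a graph iff it does so in the complement.
\<close>

section \<open>Isomorphism with the four-cycle\<close>

text \<open>Arcs of a pair digraph are the pairs of their ends, so the vertex action of an
  isomorphism forces its arc action. Later arguments can thus work with a vertex map alone.\<close>

lemma (in pair_wf_digraph) digraph_iso_with_proj_iff:
  "digraph_iso (with_proj G) (with_proj H) \<longleftrightarrow>
     (\<exists>\<phi>. inj_on \<phi> (pverts G) \<and> pverts H = \<phi> ` pverts G \<and> parcs H = map_prod \<phi> \<phi> ` parcs G)"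
    (is "?L \<longleftrightarrow> ?R")
proof
  assume ?L
  then obtain h where h: "digraph_isomorphism h" "with_proj H = app_iso h (with_proj G)"
    unfolding digraph_iso_def by blast
  \<comment> \<open>Comparing \<open>arcs_ends\<close> on both sides yields the arcs of
    \<open>H\<close> without unfolding the arc, head and tail components of
    \<open>h\<close>.\<close>
  have "parcs H = (\<lambda>(u, v). (iso_verts h u, iso_verts h v)) ` parcs G"
    using arg_cong[OF h(2), of arcs_ends] arcs_ends_app_iso_eq[OF h(1)] by simp
  moreover have "pverts H = iso_verts h ` pverts G"
    using arg_cong[OF h(2), of verts] by simp
  ultimately show ?R
    using digraph_isomorphism_inj_on_verts[OF h(1)] unfolding map_prod_def by blast
next
  assume ?R
  then obtain \<phi> where \<phi>: "inj_on \<phi> (pverts G)" "pverts H = \<phi> ` pverts G"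
    "parcs H = map_prod \<phi> \<phi> ` parcs G" by blast
  define h where "h = \<lparr> iso_verts = \<phi>, iso_arcs = map_prod \<phi> \<phi>, iso_head = snd, iso_tail = fst \<rparr>"
  have "parcs G \<subseteq> pverts G \<times> pverts G"
    using in_arcsD1 in_arcsD2 by auto
  then have "inj_on (map_prod \<phi> \<phi>) (parcs G)"
    using map_prod_inj_on[OF \<phi>(1) \<phi>(1)] inj_on_subset by blast
  then have "digraph_isomorphism h"
    using \<phi>(1) wf_digraph by (auto simp: digraph_isomorphism_def h_def)
  moreover have "with_proj H = app_iso h (with_proj G)"
    using \<phi> by (simp add: with_proj_def app_iso_def h_def)
  ultimately show ?L
    unfolding digraph_iso_def by blast
qed

lemma with_proj_induce_subgraph:
  "with_proj K \<restriction> S = with_proj \<lparr> pverts = S, parcs = parcs K \<inter> S \<times> S \<rparr>"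
  by (auto simp: induce_subgraph_def with_proj_def)

text \<open>The four-cycle is complete bipartite, with the even and the odd numbers as its sides.
  Parity replaces modular arithmetic from here on.\<close>

lemma parcs_cycle_graph_4:
  "parcs (cycle_graph 4) = {(i, j). i < 4 \<and> j < 4 \<and> even i \<noteq> even j}"
proof -
  have "(j = Suc i mod 4 \<or> i = Suc j mod 4) \<longleftrightarrow> even i \<noteq> even j" if "i < 4" "j < 4" for i j :: nat
  proof -
    have "i \<in> {0, 1, 2, 3}" "j \<in> {0, 1, 2, 3}"
      using that by auto
    then show ?thesis by (elim insertE emptyE) simp_all
  qed
  then show ?thesis by (simp add: cycle_graph_def cong: conj_cong)
qed

context pair_graph
begin

text \<open>Keeping \<open>S\<close> apart from its listing lets the same vertex set be traversed in
  different cyclic orders.\<close>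

lemma digraph_iso_cycle_graph_4I:
  assumes dist: "distinct [a, b, c, d]" and S: "S = {a, b, c, d}"
    and arcs: "(a, b) \<in> parcs G" "(b, c) \<in> parcs G" "(c, d) \<in> parcs G" "(d, a) \<in> parcs G"
    and diagonals: "(a, c) \<notin> parcs G" "(b, d) \<notin> parcs G"
  shows "digraph_iso (with_proj G \<restriction> S) (with_proj (cycle_graph 4))"
proof -
  define H where "H = \<lparr> pverts = S, parcs = parcs G \<inter> S \<times> S \<rparr>"
  interpret H: pair_wf_digraph H
    by unfold_locales (auto simp: H_def)
  \<comment> \<open>Numbering along the cycle puts the two ends of each diagonal into the same
    parity class.\<close>
  define \<phi> where "\<phi> v = (if v = a then 0 else if v = b then 1 else if v = c then 2 else 3 :: nat)" for v
  have \<phi>: "\<phi> a = 0" "\<phi> b = 1" "\<phi> c = 2" "\<phi> d = 3"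
    using dist by (auto simp: \<phi>_def)
  have inj: "inj_on \<phi> (pverts H)"
    using \<phi> by (auto simp: H_def S)
  have lt4: "{..<4} = {0, 1, 2, 3 :: nat}" by auto
  then have verts: "pverts (cycle_graph 4) = \<phi> ` pverts H"
    using \<phi> by (auto simp: H_def S cycle_graph_def)
  have diagonals': "(c, a) \<notin> parcs G" "(d, b) \<notin> parcs G"
    using diagonals arcs_symmetric by blast+
  have no_loops: "(v, v) \<notin> parcs G" for v
    using no_loops' by blast
  have arc_iff: "(u, v) \<in> parcs G \<longleftrightarrow> even (\<phi> u) \<noteq> even (\<phi> v)" if "u \<in> S" "v \<in> S" for u v
    using that arcs arcs[THEN arcs_symmetric] diagonals diagonals' no_loops \<phi>
    unfolding S by (elim insertE emptyE) simp_all
  have "parcs (cycle_graph 4) = {(i, j). i \<in> \<phi> ` S \<and> j \<in> \<phi> ` S \<and> even i \<noteq> even j}"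
    unfolding parcs_cycle_graph_4 using verts by (auto simp: H_def cycle_graph_def)
  also have "\<dots> = map_prod \<phi> \<phi> ` {(u, v). u \<in> S \<and> v \<in> S \<and> even (\<phi> u) \<noteq> even (\<phi> v)}"
    by force
  also have "{(u, v). u \<in> S \<and> v \<in> S \<and> even (\<phi> u) \<noteq> even (\<phi> v)} = parcs H"
    using arc_iff by (auto simp: H_def)
  finally have "parcs (cycle_graph 4) = map_prod \<phi> \<phi> ` parcs H" .
  with inj verts have "digraph_iso (with_proj H) (with_proj (cycle_graph 4))"
    unfolding H.digraph_iso_with_proj_iff by blast
  then show ?thesis
    by (simp add: with_proj_induce_subgraph H_def)
qed

text \<open>Under the isomorphism, adjacency becomes difference of parity. Since \<open>a\<close>,
  \<open>b\<close> differ in parity and so do \<open>c\<close>, \<open>d\<close>, the pair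
  \<open>a\<close>, \<open>c\<close> differs exactly when \<open>b\<close>, \<open>d\<close>
  does.\<close>

lemma digraph_iso_cycle_graph_4D:
  assumes iso: "digraph_iso (with_proj G \<restriction> S) (with_proj (cycle_graph 4))"
    and S: "{a, b, c, d} \<subseteq> S" and arcs: "(a, b) \<in> parcs G" "(c, d) \<in> parcs G"
  shows "(a, c) \<in> parcs G \<longleftrightarrow> (b, d) \<in> parcs G"
proof -
  define H where "H = \<lparr> pverts = S, parcs = parcs G \<inter> S \<times> S \<rparr>"
  interpret H: pair_wf_digraph H
    by unfold_locales (auto simp: H_def)
  have "digraph_iso (with_proj H) (with_proj (cycle_graph 4))"
    using iso by (simp add: with_proj_induce_subgraph H_def)
  then obtain \<phi> where \<phi>: "inj_on \<phi> S" "{..<4} = \<phi> ` S"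
    "parcs (cycle_graph 4) = map_prod \<phi> \<phi> ` (parcs G \<inter> S \<times> S)"
    unfolding H.digraph_iso_with_proj_iff by (auto simp: H_def cycle_graph_def)
  have "(u, v) \<in> parcs G \<longleftrightarrow> even (\<phi> u) \<noteq> even (\<phi> v)" if "u \<in> S" "v \<in> S" for u v
  proof -
    have "(u, v) \<in> parcs G \<longleftrightarrow> (\<phi> u, \<phi> v) \<in> map_prod \<phi> \<phi> ` (parcs G \<inter> S \<times> S)"
    proof
      assume "(u, v) \<in> parcs G"
      with that show "(\<phi> u, \<phi> v) \<in> map_prod \<phi> \<phi> ` (parcs G \<inter> S \<times> S)"
        by (intro map_prod_imageI) simp
    next
      assume "(\<phi> u, \<phi> v) \<in> map_prod \<phi> \<phi> ` (parcs G \<inter> S \<times> S)"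
      then show "(u, v) \<in> parcs G"
        using \<phi>(1) that by (auto simp: inj_on_eq_iff)
    qed
    also have "\<dots> \<longleftrightarrow> even (\<phi> u) \<noteq> even (\<phi> v)"
      using \<phi>(2) that unfolding \<phi>(3)[symmetric] parcs_cycle_graph_4 by auto
    finally show ?thesis .
  qed
  then show ?thesis
    using S arcs by auto
qed

section \<open>The permitted induced subgraphs\<close>

text \<open>The swap groups the four possible cross edges into \<open>ac\<close>, \<open>bd\<close>
  and \<open>ad\<close>, \<open>bc\<close>. If each group is present or absent as a whole, then
  both, one or no groups present gives K4, C4 or the two matching edges alone.\<close>

lemma swap_invariant_iff_permitted_subgraph:
  assumes dist: "distinct [a, b, c, d]" and arcs: "(a, b) \<in> parcs G" "(c, d) \<in> parcs G"
    and e: "e = {a, b}" "e' = {c, d}"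
  shows "(let H = with_proj G \<restriction> (e \<union> e') in
           complete_digraph 4 H \<or> digraph_iso H (with_proj (cycle_graph 4)) \<or> uedges H = {e, e'})
     \<longleftrightarrow> ((a, c) \<in> parcs G \<longleftrightarrow> (b, d) \<in> parcs G) \<and> ((a, d) \<in> parcs G \<longleftrightarrow> (b, c) \<in> parcs G)"
    (is "?L \<longleftrightarrow> ?R")
proof -
  define S where "S = e \<union> e'"
  have S: "S = {a, b, c, d}"
    by (auto simp: S_def e)
  have complete: "complete_digraph 4 (with_proj G \<restriction> S) \<longleftrightarrow> (\<forall>u\<in>S. \<forall>v\<in>S. u \<noteq> v \<longrightarrow> (u, v) \<in> parcs G)"
  proof -
    have "finite S" "card S = 4"
      using dist by (auto simp: S)
    moreover have "parcs G \<inter> S \<times> S = {(u, v). (u, v) \<in> S \<times> S \<and> u \<noteq> v} \<longleftrightarrow>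
        (\<forall>u\<in>S. \<forall>v\<in>S. u \<noteq> v \<longrightarrow> (u, v) \<in> parcs G)"
      using no_loops' by auto
    ultimately show ?thesis
      by (simp add: with_proj_induce_subgraph complete_digraph_pair_def)
  qed
  have uedges: "uedges (with_proj G \<restriction> S) = {{u, v} | u v. (u, v) \<in> parcs G \<and> u \<in> S \<and> v \<in> S}"
    by (auto simp: with_proj_induce_subgraph uedges_def)
  have sym: "(u, v) \<in> parcs G \<longleftrightarrow> (v, u) \<in> parcs G" for u v
    using arcs_symmetric by blast
  show ?thesis
  proof
    assume ?L
    then consider "complete_digraph 4 (with_proj G \<restriction> S)"
      | "digraph_iso (with_proj G \<restriction> S) (with_proj (cycle_graph 4))"
      | "uedges (with_proj G \<restriction> S) = {e, e'}"
      by (auto simp: S_def Let_def)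
    then show ?R
    proof cases
      case 1
      then show ?thesis
        unfolding complete using dist by (auto simp: S)
    next
      case 2
      then show ?thesis
        \<comment> \<open>Exchanging \<open>c\<close> and \<open>d\<close> in the second instance
          gives the other equivalence.\<close>
        using digraph_iso_cycle_graph_4D[OF 2, of a b c d] digraph_iso_cycle_graph_4D[OF 2, of a b d c]
          arcs sym S by blast
    next
      case 3
      \<comment> \<open>A cross edge would be a third edge, meeting both \<open>e\<close> and
        \<open>e'\<close>.\<close>
      have "(u, v) \<notin> parcs G" if "u \<in> e" "v \<in> e'" for u v
      proof
        assume "(u, v) \<in> parcs G"
        then have "{u, v} \<in> {e, e'}"
          using that unfolding 3[symmetric] uedges by (auto simp: S_def)
        then show False
          using that dist by (auto simp: e doubleton_eq_iff)
      qed
      then show ?thesis by (simp add: e)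
    qed
  next
    assume R: ?R
    consider "(a, c) \<in> parcs G" "(a, d) \<in> parcs G" | "(a, c) \<in> parcs G" "(a, d) \<notin> parcs G"
      | "(a, c) \<notin> parcs G" "(a, d) \<in> parcs G" | "(a, c) \<notin> parcs G" "(a, d) \<notin> parcs G"
      by blast
    then have "complete_digraph 4 (with_proj G \<restriction> S) \<or>
        digraph_iso (with_proj G \<restriction> S) (with_proj (cycle_graph 4)) \<or> uedges (with_proj G \<restriction> S) = {e, e'}"
    proof cases
      case 1
      then show ?thesis
        unfolding complete using R arcs sym by (auto simp: S)
    next
      case 2
      have "digraph_iso (with_proj G \<restriction> S) (with_proj (cycle_graph 4))"
      \<comment> \<open>The absent pairs \<open>ad\<close> and \<open>bc\<close> have to be the
        diagonals, which fixes the cyclic order.\<close>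
      proof (rule digraph_iso_cycle_graph_4I[of a b d c])
        show "distinct [a, b, d, c]" "S = {a, b, d, c}" using dist S by auto
      qed (use 2 R arcs sym in blast)+
      then show ?thesis by simp
    next
      case 3
      have "digraph_iso (with_proj G \<restriction> S) (with_proj (cycle_graph 4))"
      proof (rule digraph_iso_cycle_graph_4I[of a b c d])
        show "distinct [a, b, c, d]" "S = {a, b, c, d}" using dist S by auto
      qed (use 3 R arcs sym in blast)+
      then show ?thesis by simp
    next
      case 4
      then have no_cross: "(u, v) \<notin> parcs G" "(v, u) \<notin> parcs G" if "u \<in> e" "v \<in> e'" for u v
        using R sym that by (auto simp: e)
      have "{u, v} = e \<or> {u, v} = e'" if uv: "(u, v) \<in> parcs G" "u \<in> S" "v \<in> S" for u v
      proof -
        have "u \<noteq> v"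
          using uv(1) no_loops' by blast
        moreover have "u \<in> e \<and> v \<in> e \<or> u \<in> e' \<and> v \<in> e'"
          using uv no_cross unfolding S_def by blast
        ultimately show ?thesis
          unfolding e by (auto simp: doubleton_eq_iff)
      qed
      moreover have "e \<in> uedges (with_proj G \<restriction> S)" "e' \<in> uedges (with_proj G \<restriction> S)"
        unfolding uedges unfolding S e using arcs by blast+
      ultimately have "uedges (with_proj G \<restriction> S) = {e, e'}"
        unfolding uedges by blast
      then show ?thesis by simp
    qed
    then show ?L
      by (simp add: S_def Let_def)
  qed
qed

section \<open>Passing between oppositions and opposition matchings\<close>

lemma parcs_complement_iff:
  assumes "u \<in> pverts G" "v \<in> pverts G"
  shows "(u, v) \<in> parcs (complement G) \<longleftrightarrow> u \<noteq> v \<and> (u, v) \<notin> parcs G"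
  using assms by (simp add: complement_def)

text \<open>The matching consists of the orbits of \<open>f\<close>. That \<open>f v\<close> avoids
  the closed neighbourhood of \<open>v\<close> makes each orbit an edge of the complement.\<close>

lemma opposition_imp_opposition_matching:
  assumes "opposition G f"
  shows "opposition_matching (complement G) {{v, f v} | v. v \<in> pverts G}" (is "opposition_matching ?K ?M")
proof -
  interpret K: pair_graph ?K
    by (rule pair_graph_complement) (rule pair_graph)
  have aut: "bij_betw f (pverts G) (pverts G)"
    "\<And>u v. u \<in> pverts G \<Longrightarrow> v \<in> pverts G \<Longrightarrow> (f u, f v) \<in> parcs G \<longleftrightarrow> (u, v) \<in> parcs G"
    using assms automorphism_iff[OF pair_graph] by (auto simp: opposition_def)
  have ff: "f (f v) = v" and fv: "f v \<in> pverts G" and arc: "(v, f v) \<in> parcs ?K"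
    if "v \<in> pverts G" for v
    using assms that aut(1) by (auto simp: opposition_def closed_nbhd_def complement_def bij_betw_def)
  have arc_iff: "(f u, f v) \<in> parcs ?K \<longleftrightarrow> (u, v) \<in> parcs ?K" if "u \<in> pverts G" "v \<in> pverts G" for u v
    using that aut fv by (auto simp: parcs_complement_iff bij_betw_def inj_on_eq_iff)
  have disjoint: "distinct [u, f u, v, f v]"
    if "u \<in> pverts G" "v \<in> pverts G" "{u, f u} \<noteq> {v, f v}" for u v
  proof -
    have "u \<noteq> f u" "v \<noteq> f v"
      using that arc K.no_loops' by blast+
    moreover have "u \<noteq> v"
      using that(3) by auto
    \<comment> \<open>Orbits of an involution that share a vertex coincide.\<close>
    moreover have "f u \<noteq> f v" "u \<noteq> f v" "f u \<noteq> v"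
      using that ff by (metis insert_commute)+
    ultimately show ?thesis by auto
  qed
  have "perfect_matching ?K ?M"
    unfolding perfect_matching_def
  proof (intro conjI ballI impI)
    show "?M \<subseteq> uedges (with_proj ?K)"
      using arc by (auto simp: uedges_def)
    show "\<Union>?M = pverts ?K"
      using fv by (auto simp: complement_def)
    fix e e' assume "e \<in> ?M" "e' \<in> ?M" "e \<noteq> e'"
    then obtain u v where "u \<in> pverts G" "v \<in> pverts G" "e = {u, f u}" "e' = {v, f v}" by blast
    with disjoint[of u v] \<open>e \<noteq> e'\<close> show "e \<inter> e' = {}" by auto
  qed
  moreover have "let H = with_proj ?K \<restriction> (e \<union> e') in
           complete_digraph 4 H \<or> digraph_iso H (with_proj (cycle_graph 4)) \<or> uedges H = {e, e'}"
    if ee': "e \<in> ?M" "e' \<in> ?M" "e \<noteq> e'" for e e'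
  proof -
    obtain u v where uv: "u \<in> pverts G" "v \<in> pverts G" and e: "e = {u, f u}" "e' = {v, f v}"
      using ee' by blast
    have "distinct [u, f u, v, f v]"
      using disjoint uv e ee'(3) by blast
    \<comment> \<open>Invariance under \<open>f\<close>, applied to \<open>u\<close> and
      \<open>f v\<close>, settles the second group of cross edges because
      \<open>f (f v) = v\<close>.\<close>
    moreover have "(u, f v) \<in> parcs ?K \<longleftrightarrow> (f u, v) \<in> parcs ?K"
      using arc_iff[of u "f v"] uv fv ff by auto
    ultimately show ?thesis
      using K.swap_invariant_iff_permitted_subgraph[OF _ arc arc e] arc_iff uv by blast
  qed
  ultimately show ?thesis
    unfolding opposition_matching_def by blast
qed

lemma opposition_matching_imp_opposition:
  assumes M: "opposition_matching (complement G) M" (is "opposition_matching ?K M")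
  shows "\<exists>f. opposition G f"
proof -
  \<comment> \<open>\<open>f\<close> sends a vertex to its partner in \<open>M\<close>, which is
    unique because distinct edges of \<open>M\<close> are disjoint.\<close>
  define f where "f v = (THE w. {v, w} \<in> M)" for v
  interpret K: pair_graph ?K
    by (rule pair_graph_complement) (rule pair_graph)
  have pm: "M \<subseteq> uedges (with_proj ?K)" "\<And>e e'. e \<in> M \<Longrightarrow> e' \<in> M \<Longrightarrow> e \<noteq> e' \<Longrightarrow> e \<inter> e' = {}"
    "\<Union>M = pverts G"
    using M by (auto simp: opposition_matching_def perfect_matching_def complement_def)
  have f_eqI: "f v = w" if "{v, w} \<in> M" for v w
  unfolding f_def
  proof (rule the_equality)
    show "{v, w} \<in> M" by (fact that)
  next
    fix w' assume "{v, w'} \<in> M"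
    with that pm(2)[of "{v, w}" "{v, w'}"] show "w' = w"
      by (auto simp: doubleton_eq_iff)
  qed
  have edge: "{v, f v} \<in> M" and arc: "(v, f v) \<in> parcs ?K" if v: "v \<in> pverts G" for v
  proof -
    obtain e where e: "e \<in> M" "v \<in> e"
      using v pm(3) by blast
    then obtain x y where "e = {x, y}" "(x, y) \<in> parcs ?K"
      using pm(1) by (auto simp: uedges_def)
    \<comment> \<open>An edge in \<open>uedges\<close> comes with an arbitrary orientation; symmetry
      lets it start at \<open>v\<close>.\<close>
    with e(2) obtain w where "e = {v, w}" "(v, w) \<in> parcs ?K"
      using K.arcs_symmetric by blast
    then show "{v, f v} \<in> M" "(v, f v) \<in> parcs ?K"
      using e(1) f_eqI by auto
  qed
  have ff: "f (f v) = v" if "v \<in> pverts G" for v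
    using f_eqI[of "f v" v] edge[OF that] by (simp add: insert_commute)
  have fv: "f v \<in> pverts G" if "v \<in> pverts G" for v
    using edge[OF that] pm(3) by blast
  have bij: "bij_betw f (pverts G) (pverts G)"
    by (rule bij_betw_byWitness[where f' = f]) (use ff fv in auto)
  have arc_iff: "(f u, f v) \<in> parcs ?K \<longleftrightarrow> (u, v) \<in> parcs ?K"
    if uv: "u \<in> pverts G" "v \<in> pverts G" for u v
  \<comment> \<open>If both vertices lie on one matching edge, the claim compares two loops or the
    two directions of that edge. Otherwise two distinct edges of \<open>M\<close> are involved and
    the matching condition applies.\<close>
  proof (cases "v = u \<or> v = f u")
    case True
    then show ?thesis
      using K.no_loops' ff[OF uv(1)] K.arcs_symmetric by (elim disjE; simp; blast)
  next
    case False
    have ne: "{u, f u} \<noteq> {v, f v}"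
      using False by (auto simp: doubleton_eq_iff)
    have "{u, f u} \<inter> {v, f v} = {}"
      using pm(2) edge uv ne by blast
    then have "distinct [u, f u, v, f v]"
      using K.no_loops'[OF arc[OF uv(1)]] K.no_loops'[OF arc[OF uv(2)]] by auto
    from K.swap_invariant_iff_permitted_subgraph[OF this arc[OF uv(1)] arc[OF uv(2)] refl refl]
    show ?thesis
      using M[unfolded opposition_matching_def, THEN conjunct2, rule_format,
          OF edge[OF uv(1)] edge[OF uv(2)] ne] by simp
  qed
  have "(f u, f v) \<in> parcs G \<longleftrightarrow> (u, v) \<in> parcs G" if uv: "u \<in> pverts G" "v \<in> pverts G" for u v
  \<comment> \<open>Adjacency in the complement is the negation of adjacency in \<open>G\<close>
    only for distinct vertices, so equal ones are treated separately.\<close>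
  proof (cases "u = v")
    case True
    then show ?thesis using no_loops' by blast
  next
    case False
    then have "f u \<noteq> f v"
      using ff uv by metis
    then show ?thesis
      using arc_iff[OF uv] False uv fv by (simp add: parcs_complement_iff)
  qed
  then have "automorphism G f"
    using bij automorphism_iff[OF pair_graph] by blast
  moreover have "f v \<notin> closed_nbhd G v" if "v \<in> pverts G" for v
    using arc[OF that] by (auto simp: closed_nbhd_def complement_def)
  ultimately have "opposition G f"
    using ff by (simp add: opposition_def)
  then show ?thesis by blast
qed

end

theorem theorem2p3:
  fixes G :: "'a pair_pre_digraph"
  assumes "pair_graph G"
  shows "(\<exists>f. opposition G f) \<longleftrightarrow> (\<exists>M. opposition_matching (complement G) M)"
  using pair_graph.opposition_imp_opposition_matching[OF assms]
    pair_graph.opposition_matching_imp_opposition[OF assms] by blast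

end
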